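(* Let $E$ be an arbitrary directed graph. The following conditions are equivalent. (1) There is a comparable generator of $F_E^\Gamma$. (2) There is a nonzero comparable element of $F_E^\Gamma$. (3) The graph $E$ has a cycle.
   Context: Setup. $\Gamma=\{x^n\mid n\in\mathbb Z\}$ is the infinite cyclic group generated by $x$. $E$ is an arbitrary directed graph with vertex set $E^0$, edge set $E^1$, source map $\mathbf s$ and range map $\mathbf r$. A vertex $v$ is regular if $\mathbf s^{-1}(v)$ is finite and nonempty, and an infinite emitter if $\mathbf s^{-1}(v)$ is infinite. For every infinite emitter $v$ and every finite nonempty $Z\subseteq \mathbf s^{-1}(v)$ introduce a symbol $q_Z=q_Z^v$, called an improper vertex; elements of $E^0$ are called proper vertices. $F_E^\Gamma$ is the free commutative $\Gamma$-monoid on all proper and improper vertices (these are called the generators): its elements are finite formal sums of monomials $x^m g$ ($m\in\mathbb Z$, $g$ a generator), and $x^n$ acts by $x^n(x^m g)=x^{n+m}g$. The relation $\to_1$ on $F_E^\Gamma-\{0\}$ is given, for all $a\in F_E^\Gamma$ and $m\in\mathbb Z$, by: (A1) $a+x^m v\to_1 a+\sum_{e\in \mathbf s^{-1}(v)}x^{m+1}\mathbf r(e)$ for $v$ regular; (A2) $a+x^m v\to_1 a+x^m q_Z+\sum_{e\in Z}x^{m+1}\mathbf r(e)$ for $v$ an infinite emitter and $Z\subseteq \mathbf s^{-1}(v)$ finite and nonempty; (A3) $a+x^m q_Z\to_1 a+x^m q_W+\sum_{e\in W-Z}x^{m+1}\mathbf r(e)$ for $v$ an infinite emitter and finite nonempty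 $Z\subsetneq W\subseteq \mathbf s^{-1}(v)$. $\sim$ is the congruence on $F_E^\Gamma$ generated by $\to_1$. For $a,b\in F_E^\Gamma$, $a\precsim b$ (also $b\succsim a$) means that $a+c\sim b$ for some $c\in F_E^\Gamma$. An element $a$ is comparable if $a\succsim x^n a$ for some positive integer $n$. A cycle is a closed path $e_1\cdots e_n$, $n\geq 1$, with $\mathbf s(e_i)\neq \mathbf s(e_j)$ for $i\ne j$. *)

theory Defs
  imports "HOL-Library.Multiset" "Graph_Theory.Arc_Walk"
begin

text \<open>
  A directed graph is a \<^locale>\<open>wf_digraph\<close>: the source and range maps are \<^const>\<open>tail\<close> and
  \<^const>\<open>head\<close>, and no finiteness is imposed. The set of edges emitted by \<open>v\<close> is
  \<open>out_arcs E v\<close>.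
\<close>

definition regular :: "('v, 'e) pre_digraph \<Rightarrow> 'v \<Rightarrow> bool" where
  "regular E v \<longleftrightarrow> v \<in> verts E \<and> finite (out_arcs E v) \<and> out_arcs E v \<noteq> {}"

definition infinite_emitter :: "('v, 'e) pre_digraph \<Rightarrow> 'v \<Rightarrow> bool" where
  "infinite_emitter E v \<longleftrightarrow> v \<in> verts E \<and> infinite (out_arcs E v)"

definition is_cycle :: "('v, 'e) pre_digraph \<Rightarrow> 'e list \<Rightarrow> bool" where
  "is_cycle E p \<longleftrightarrow> p \<noteq> [] \<and> (\<exists>u. pre_digraph.awalk E u p u) \<and> distinct (map (tail E) p)"

text \<open>\<open>Improper v Z\<close> is the improper vertex \<open>q_Z\<close> at the infinite emitter \<open>v\<close>.\<close>

datatype ('v, 'e) vertex = Proper 'v | Improper 'v "'e set"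

definition generators :: "('v, 'e) pre_digraph \<Rightarrow> ('v, 'e) vertex set" where
  "generators E = Proper ` verts E \<union>
     {Improper v Z | v Z. infinite_emitter E v \<and> finite Z \<and> Z \<noteq> {} \<and> Z \<subseteq> out_arcs E v}"

text \<open>
  The pair \<open>(m, g)\<close> stands for the monomial \<open>x^m g\<close>, where the infinite cyclic group generated by
  \<open>x\<close> is written additively as \<^typ>\<open>int\<close>. Finite formal sums of monomials are multisets, so the
  monoid operation and its unit are \<open>+\<close> and \<open>{#}\<close>.
\<close>

type_synonym ('v, 'e) gamma_elem = "(int \<times> ('v, 'e) vertex) multiset"

abbreviation monom :: "int \<Rightarrow> ('v, 'e) vertex \<Rightarrow> ('v, 'e) gamma_elem" where
  "monom m g \<equiv> {#(m, g)#}"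

definition free_gamma_monoid :: "('v, 'e) pre_digraph \<Rightarrow> ('v, 'e) gamma_elem set" where
  "free_gamma_monoid E = {a. set_mset a \<subseteq> UNIV \<times> generators E}"

definition gamma_act :: "int \<Rightarrow> ('v, 'e) gamma_elem \<Rightarrow> ('v, 'e) gamma_elem" where
  "gamma_act n a = image_mset (\<lambda>(m, g). (n + m, g)) a"

inductive step1 :: "('v, 'e) pre_digraph \<Rightarrow> ('v, 'e) gamma_elem \<Rightarrow> ('v, 'e) gamma_elem \<Rightarrow> bool"
  for E where
  A1: "\<lbrakk>a \<in> free_gamma_monoid E; regular E v\<rbrakk> \<Longrightarrow>
    step1 E (a + monom m (Proper v))
            (a + (\<Sum>e\<in>out_arcs E v. monom (m + 1) (Proper (head E e))))"
| A2: "\<lbrakk>a \<in> free_gamma_monoid E; infinite_emitter E v;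
        finite Z; Z \<noteq> {}; Z \<subseteq> out_arcs E v\<rbrakk> \<Longrightarrow>
    step1 E (a + monom m (Proper v))
            (a + monom m (Improper v Z) + (\<Sum>e\<in>Z. monom (m + 1) (Proper (head E e))))"
| A3: "\<lbrakk>a \<in> free_gamma_monoid E; infinite_emitter E v;
        finite W; Z \<noteq> {}; Z \<subset> W; W \<subseteq> out_arcs E v\<rbrakk> \<Longrightarrow>
    step1 E (a + monom m (Improper v Z))
            (a + monom m (Improper v W) + (\<Sum>e\<in>W - Z. monom (m + 1) (Proper (head E e))))"

text \<open>
  The congruence of commutative \<open>\<Gamma>\<close>-monoids generated by \<^const>\<open>step1\<close>. Closure under the action
  adds nothing to the plain monoid congruence, as \<^const>\<open>step1\<close> is already invariant under it.
\<close>

inductive sim :: "('v, 'e) pre_digraph \<Rightarrow> ('v, 'e) gamma_elem \<Rightarrow> ('v, 'e) gamma_elem \<Rightarrow> bool"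
  for E where
  sim_step: "step1 E a b \<Longrightarrow> sim E a b"
| sim_refl: "a \<in> free_gamma_monoid E \<Longrightarrow> sim E a a"
| sim_sym: "sim E a b \<Longrightarrow> sim E b a"
| sim_trans: "\<lbrakk>sim E a b; sim E b c\<rbrakk> \<Longrightarrow> sim E a c"
| sim_add: "\<lbrakk>sim E a b; sim E c d\<rbrakk> \<Longrightarrow> sim E (a + c) (b + d)"
| sim_act: "sim E a b \<Longrightarrow> sim E (gamma_act n a) (gamma_act n b)"

definition precsim :: "('v, 'e) pre_digraph \<Rightarrow> ('v, 'e) gamma_elem \<Rightarrow> ('v, 'e) gamma_elem \<Rightarrow> bool"
  where "precsim E a b \<longleftrightarrow> (\<exists>c\<in>free_gamma_monoid E. sim E (a + c) b)"

definition comparable :: "('v, 'e) pre_digraph \<Rightarrow> ('v, 'e) gamma_elem \<Rightarrow> bool" where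
  "comparable E a \<longleftrightarrow> (\<exists>n>0. precsim E (gamma_act n a) a)"

end

theory Submission
  imports Complex_Main Defs
begin

text \<open>
  Following a cycle from a vertex \<open>v\<close> of length \<open>n\<close> yields \<open>v \<sim> x\<^sup>n v + c\<close>, so \<open>v\<close> is comparable.

  Conversely, suppose that \<open>E\<close> has no cycle. A derivation of \<open>x\<^sup>n a + c \<sim> a\<close> involves only finitely many
  arcs; let \<open>F\<close> be a finite set of arcs that contains them. Since \<open>F\<close> is acyclic, one can define a positive
  weight on the generators by recursion along \<open>F\<close> such that, with \<open>x\<close> acting as multiplication by 2, the
  weight is preserved by every step of the derivation. Then \<open>a\<close> and \<open>x\<^sup>n a + c\<close> have the same weight,
  but the latter has at least \<open>2\<^sup>n\<close> times the weight of \<open>a\<close>. Hence \<open>a = 0\<close>.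
\<close>

section \<open>Cycles give comparable vertices\<close>

lemma free_gamma_monoid_empty [simp]: "{#} \<in> free_gamma_monoid E"
  by (simp add: free_gamma_monoid_def)

lemma free_gamma_monoid_add [simp]:
  "a + b \<in> free_gamma_monoid E \<longleftrightarrow> a \<in> free_gamma_monoid E \<and> b \<in> free_gamma_monoid E"
  by (auto simp: free_gamma_monoid_def)

lemma free_gamma_monoid_monom [simp]: "monom m g \<in> free_gamma_monoid E \<longleftrightarrow> g \<in> generators E"
  by (auto simp: free_gamma_monoid_def)

lemma free_gamma_monoid_sum:
  "(\<And>i. i \<in> A \<Longrightarrow> f i \<in> free_gamma_monoid E) \<Longrightarrow> (\<Sum>i\<in>A. f i) \<in> free_gamma_monoid E"
  by (induction A rule: infinite_finite_induct) auto

lemma Proper_in_generators: "v \<in> verts E \<Longrightarrow> Proper v \<in> generators E"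
  by (simp add: generators_def)

lemma precsim_refl: "a \<in> free_gamma_monoid E \<Longrightarrow> precsim E a a"
  unfolding precsim_def by (intro bexI[of _ "{#}"]) (auto intro: sim_refl)

lemma precsim_trans:
  assumes "precsim E a b" "precsim E b c"
  shows "precsim E a c"
proof -
  obtain d d' where d: "d \<in> free_gamma_monoid E" "sim E (a + d) b"
    and d': "d' \<in> free_gamma_monoid E" "sim E (b + d') c"
    using assms by (auto simp: precsim_def)
  have "sim E (a + d + d') (b + d')"
    using d d' by (intro sim_add sim_refl)
  then have "sim E (a + (d + d')) c"
    using sim_trans[OF _ d'(2)] by (simp add: add.assoc)
  then show ?thesis
    using d d' by (auto simp: precsim_def)
qed

context wf_digraph
begin

text \<open>If the tail is regular, A1 rewrites it to a sum with the head of \<open>e\<close> as one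
  summand, and the other summands form the complement. If it is an infinite emitter, A2 with
  \<open>Z = {e}\<close> leaves the improper vertex as complement.\<close>

lemma precsim_arc:
  assumes e: "e \<in> arcs G"
  shows "precsim G (monom (m + 1) (Proper (head G e))) (monom m (Proper (tail G e)))"
proof -
  let ?v = "tail G e"
  let ?f = "\<lambda>e. monom (m + 1) (Proper (head G e)) :: ('a, 'b) gamma_elem"
  have v: "?v \<in> verts G" "e \<in> out_arcs G ?v"
    using e by auto
  show ?thesis
  proof (cases "finite (out_arcs G ?v)")
    case True
    then have "regular G ?v"
      using v by (auto simp: regular_def)
    from sim_sym[OF sim_step[OF A1[OF free_gamma_monoid_empty this, of m]]]
    have "sim G (\<Sum>e\<in>out_arcs G ?v. ?f e) (monom m (Proper ?v))"
      by simp
    then have "sim G (?f e + (\<Sum>e\<in>out_arcs G ?v - {e}. ?f e)) (monom m (Proper ?v))"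
      using True v by (simp only: sum.remove)
    moreover have "(\<Sum>e\<in>out_arcs G ?v - {e}. ?f e) \<in> free_gamma_monoid G"
      by (rule free_gamma_monoid_sum) (simp add: Proper_in_generators)
    ultimately show ?thesis
      unfolding precsim_def by blast
  next
    case False
    then have inf: "infinite_emitter G ?v"
      using v by (simp add: infinite_emitter_def)
    have "step1 G ({#} + monom m (Proper ?v))
      ({#} + monom m (Improper ?v {e}) + (\<Sum>e\<in>{e}. ?f e))"
      using inf v by (intro A2) auto
    from sim_sym[OF sim_step[OF this]]
    have "sim G (?f e + monom m (Improper ?v {e})) (monom m (Proper ?v))"
      by (simp add: add_mset_commute)
    moreover have "monom m (Improper ?v {e}) \<in> free_gamma_monoid G"
      using inf v by (auto simp: generators_def)
    ultimately show ?thesis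
      unfolding precsim_def by blast
  qed
qed

lemma precsim_awalk:
  "awalk u p v \<Longrightarrow> precsim G (monom (m + int (length p)) (Proper v)) (monom m (Proper u))"
proof (induction p arbitrary: u m)
  case Nil
  then show ?case
    by (auto simp: awalk_Nil_iff Proper_in_generators intro: precsim_refl)
next
  case (Cons e p)
  then have e: "e \<in> arcs G" "u = tail G e" and p: "awalk (head G e) p v"
    by (auto simp: awalk_Cons_iff)
  have "precsim G (monom (m + int (length (e # p))) (Proper v)) (monom (m + 1) (Proper (head G e)))"
    using Cons.IH[OF p, of "m + 1"] by (simp add: algebra_simps)
  with precsim_arc[OF e(1), of m] show ?case
    unfolding e(2) by (rule precsim_trans[rotated])
qed

lemma comparable_closed_walk:
  assumes "awalk u p u" "p \<noteq> []"
  shows "comparable G (monom 0 (Proper u))"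
  using precsim_awalk[OF assms(1), of 0] assms(2)
  by (auto simp: comparable_def gamma_act_def intro!: exI[of _ "int (length p)"])

section \<open>Closed walks, cycles and acyclicity\<close>

text \<open>The predicate \<open>cycle\<close> asks for distinct heads, \<open>is_cycle\<close> for
  distinct tails. Along a closed walk the heads are a rotation of the tails.\<close>

lemma cycle_imp_is_cycle:
  assumes "cycle p"
  shows "is_cycle G p"
proof -
  obtain u where u: "awalk u p u" and dist: "distinct (tl (awalk_verts u p))" and p: "p \<noteq> []"
    using assms by (auto simp: cycle_def)
  from u have cas: "cas u p u" and last: "awlast u p = u" and hd: "awhd u p = u"
    by auto
  \<comment> \<open>The vertex list is read in two ways, starting or ending with the extra
    \<open>u\<close>; cancelling \<open>u\<close> in the multisets identifies heads and
    tails.\<close>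
  have "awalk_verts u p = u # map (head G) p"
    using awalk_verts_conv'[OF cas] hd p by simp
  moreover have "awalk_verts u p = map (tail G) p @ [u]"
    using awalk_verts_conv[of u p] last p by simp
  ultimately have "mset (u # map (head G) p) = mset (map (tail G) p @ [u])"
    by simp
  then have "mset (map (head G) p) = mset (map (tail G) p)"
    by simp
  moreover have "distinct (map (head G) p)"
    using dist p by (simp add: awalk_verts_conv'[OF cas])
  ultimately have "distinct (map (tail G) p)"
    using mset_eq_imp_distinct_iff by blast
  with u p show ?thesis
    by (auto simp: is_cycle_def)
qed

lemma acyclic_if_no_cycle:
  assumes "\<nexists>p. is_cycle G p"
  shows "acyclic (arcs_ends G)"
proof (rule acyclicI, rule allI, rule notI)
  fix u assume "u \<rightarrow>\<^sup>+ u"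
  then obtain p where "awalk u p u" "p \<noteq> []"
    by (auto simp: reachable1_awalk)
  then have "closed_w p"
    by (auto simp: closed_w_def)
  then show False
    using closed_w_imp_cycle cycle_imp_is_cycle assms by blast
qed

end

section \<open>Weights on acyclic graphs\<close>

text \<open>The head is the smaller element, so recursion at a vertex may call the heads of its arcs
  in \<open>F\<close>.\<close>

definition arc_rel :: "('v, 'e) pre_digraph \<Rightarrow> 'e set \<Rightarrow> 'v rel" where
  "arc_rel E F = (\<lambda>e. (head E e, tail E e)) ` F"

text \<open>
  The summand 1 keeps weights positive where the recursion along \<open>F\<close> stops; at an infinite emitter \<open>v\<close> it is
  the part of the weight that \<open>v\<close> shares with all its improper vertices \<open>q\<^sub>Z\<close>.
\<close>

definition vertex_weight :: "('v, 'e) pre_digraph \<Rightarrow> 'e set \<Rightarrow> 'v \<Rightarrow> real" where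
  "vertex_weight E F = wfrec (arc_rel E F)
     (\<lambda>w v. (if regular E v \<and> out_arcs E v \<subseteq> F then 0 else 1) +
       (\<Sum>e\<in>out_arcs E v \<inter> F. 2 * w (head E e)))"

text \<open>The weight of \<open>Improper v Z\<close> is forced by A2: for \<open>Z\<close> inside
  \<open>F\<close>, it is what remains of the weight of \<open>v\<close> once the arcs in
  \<open>Z\<close> have been paid for.\<close>

fun gen_weight :: "('v, 'e) pre_digraph \<Rightarrow> 'e set \<Rightarrow> ('v, 'e) vertex \<Rightarrow> real" where
  "gen_weight E F (Proper v) = vertex_weight E F v"
| "gen_weight E F (Improper v Z) = 1 + (\<Sum>e\<in>out_arcs E v \<inter> F - Z. 2 * vertex_weight E F (head E e))"

definition weight :: "('v, 'e) pre_digraph \<Rightarrow> 'e set \<Rightarrow> ('v, 'e) gamma_elem \<Rightarrow> real" where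
  "weight E F a = (\<Sum>(m, g)\<in>#a. 2 powi m * gen_weight E F g)"

lemma vertex_weight_unfold:
  assumes "wf (arc_rel E F)"
  shows "vertex_weight E F v = (if regular E v \<and> out_arcs E v \<subseteq> F then 0 else 1) +
    (\<Sum>e\<in>out_arcs E v \<inter> F. 2 * vertex_weight E F (head E e))"
proof -
  have "cut f (arc_rel E F) v (head E e) = f (head E e)"
    if "e \<in> out_arcs E v \<inter> F" for e and f :: "_ \<Rightarrow> real"
    using that by (intro cut_apply) (auto simp: arc_rel_def)
  then show ?thesis
    unfolding vertex_weight_def by (subst wfrec[OF assms]) simp
qed

text \<open>Either the summand 1 is present, or \<open>v\<close> is regular with all its arcs in
  \<open>F\<close>, and then the sum is nonempty with terms positive by induction.\<close>

lemma vertex_weight_pos: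
  assumes wf: "wf (arc_rel E F)" and F: "finite F"
  shows "vertex_weight E F v > 0"
  using wf
proof (induction v rule: wf_induct_rule)
  case (less v)
  have IH: "vertex_weight E F (head E e) > 0" if "e \<in> out_arcs E v \<inter> F" for e
    using that by (intro less) (auto simp: arc_rel_def)
  have "(\<Sum>e\<in>out_arcs E v \<inter> F. 2 * vertex_weight E F (head E e)) > 0"
    if "regular E v" "out_arcs E v \<subseteq> F"
    using that F IH by (intro sum_pos) (auto simp: regular_def)
  moreover have "(\<Sum>e\<in>out_arcs E v \<inter> F. 2 * vertex_weight E F (head E e)) \<ge> 0"
    using IH by (intro sum_nonneg) (simp add: less_imp_le)
  ultimately show ?case
    unfolding vertex_weight_unfold[OF wf, of v] by auto
qed

lemma gen_weight_pos:
  assumes "wf (arc_rel E F)" "finite F"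
  shows "gen_weight E F g > 0"
proof (cases g)
  case (Improper v Z)
  have "(\<Sum>e\<in>out_arcs E v \<inter> F - Z. 2 * vertex_weight E F (head E e)) \<ge> 0"
    using vertex_weight_pos[OF assms] by (intro sum_nonneg) (simp add: less_imp_le)
  with Improper show ?thesis
    by simp
qed (simp add: vertex_weight_pos[OF assms])

lemma weight_empty [simp]: "weight E F {#} = 0"
  by (simp add: weight_def)

lemma weight_add [simp]: "weight E F (a + b) = weight E F a + weight E F b"
  by (simp add: weight_def)

lemma weight_add_mset [simp]:
  "weight E F (add_mset (m, g) a) = 2 powi m * gen_weight E F g + weight E F a"
  by (simp add: weight_def)

lemma weight_sum: "weight E F (\<Sum>i\<in>A. f i) = (\<Sum>i\<in>A. weight E F (f i))"
  by (induction A rule: infinite_finite_induct) auto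

text \<open>The factor 2 in the recursion absorbs the shift of the exponent from \<open>m\<close> to
  \<open>m + 1\<close>.\<close>

lemma weight_sum_heads:
  "weight E F (\<Sum>e\<in>A. monom (m + 1) (Proper (head E e))) =
     2 powi m * (\<Sum>e\<in>A. 2 * vertex_weight E F (head E e))"
  by (simp add: weight_sum power_int_add_1 sum_distrib_left mult.assoc)

lemma weight_gamma_act: "weight E F (gamma_act n a) = 2 powi n * weight E F a"
  by (induction a) (auto simp: weight_def gamma_act_def power_int_add algebra_simps)

lemma weight_nonneg:
  assumes "wf (arc_rel E F)" "finite F"
  shows "weight E F a \<ge> 0"
  using gen_weight_pos[OF assms] by (induction a) (auto simp: less_imp_le)

lemma weight_pos:
  assumes "wf (arc_rel E F)" "finite F" "a \<noteq> {#}"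
  shows "weight E F a > 0"
proof -
  obtain m g b where "a = add_mset (m, g) b"
    using assms(3) by (cases a) auto
  then show ?thesis
    using gen_weight_pos[OF assms(1,2)] weight_nonneg[OF assms(1,2)]
    by (simp add: add_pos_nonneg)
qed

lemma vertex_weight_regular:
  assumes "wf (arc_rel E F)" "regular E v" "out_arcs E v \<subseteq> F"
  shows "vertex_weight E F v = (\<Sum>e\<in>out_arcs E v. 2 * vertex_weight E F (head E e))"
  using vertex_weight_unfold[OF assms(1), of v] assms(2,3) by (simp add: Int_absorb2)

lemma vertex_weight_infinite_emitter:
  assumes "wf (arc_rel E F)" "finite F" "infinite_emitter E v" "Z \<subseteq> out_arcs E v" "Z \<subseteq> F"
  shows "vertex_weight E F v =
    gen_weight E F (Improper v Z) + (\<Sum>e\<in>Z. 2 * vertex_weight E F (head E e))"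
proof -
  have "\<not> regular E v"
    using assms(3) by (simp add: regular_def infinite_emitter_def)
  moreover have "sum f (out_arcs E v \<inter> F) = sum f (out_arcs E v \<inter> F - Z) + sum f Z"
    for f :: "_ \<Rightarrow> real"
    using assms by (intro sum.subset_diff) auto
  ultimately show ?thesis
    by (simp add: vertex_weight_unfold[OF assms(1), of v])
qed

section \<open>Invariance of the weight under the congruence\<close>

lemma eventually_superset_finite_subsets_at_top:
  assumes "finite X" "X \<subseteq> A"
  shows "\<forall>\<^sub>F F in finite_subsets_at_top A. finite F \<and> X \<subseteq> F"
  using assms by (auto simp: eventually_finite_subsets_at_top)

text \<open>Invariance needs \<open>F\<close> to contain only finitely many given arcs: those
  leaving \<open>v\<close> for A1, those in \<open>Z\<close> for A2, those in \<open>W\<close> for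
  A3.\<close>

lemma step1_weight:
  assumes "step1 E a b" and wf: "\<And>F. finite F \<Longrightarrow> F \<subseteq> arcs E \<Longrightarrow> wf (arc_rel E F)"
  shows "\<forall>\<^sub>F F in finite_subsets_at_top (arcs E). weight E F a = weight E F b"
proof -
  have ev_wf: "\<forall>\<^sub>F F in finite_subsets_at_top (arcs E). wf (arc_rel E F)"
    using wf by (intro eventually_finite_subsets_at_top_weakI)
  from assms(1) show ?thesis
  proof cases
    case (A1 c v m)
    then have "finite (out_arcs E v)"
      by (simp add: regular_def)
    then have "\<forall>\<^sub>F F in finite_subsets_at_top (arcs E). finite F \<and> out_arcs E v \<subseteq> F"
      by (rule eventually_superset_finite_subsets_at_top) auto
    with ev_wf show ?thesis
    proof eventually_elim
      case (elim F)
      then show ?case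
        using A1 by (simp add: weight_sum_heads vertex_weight_regular)
    qed
  next
    case (A2 c v Z m)
    then have "\<forall>\<^sub>F F in finite_subsets_at_top (arcs E). finite F \<and> Z \<subseteq> F"
      by (intro eventually_superset_finite_subsets_at_top) auto
    with ev_wf show ?thesis
    proof eventually_elim
      case (elim F)
      then show ?case
        using A2 vertex_weight_infinite_emitter[of E F v Z]
        by (simp add: weight_sum_heads distrib_left del: gen_weight.simps(2))
    qed
  next
    case (A3 c v W Z m)
    then have "\<forall>\<^sub>F F in finite_subsets_at_top (arcs E). finite F \<and> W \<subseteq> F"
      by (intro eventually_superset_finite_subsets_at_top) auto
    with ev_wf show ?thesis
    proof eventually_elim
      case (elim F)
      let ?s = "\<lambda>A. \<Sum>e\<in>A. 2 * vertex_weight E F (head E e)"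
      \<comment> \<open>The two improper vertices are compared through \<open>v\<close>: its weight
        decomposes along \<open>Z\<close> and along \<open>W\<close>, and the sum over
        \<open>Z\<close> cancels.\<close>
      have "?s W = ?s (W - Z) + ?s Z"
        using A3 by (intro sum.subset_diff) auto
      then have "gen_weight E F (Improper v Z) = gen_weight E F (Improper v W) + ?s (W - Z)"
        using elim A3 vertex_weight_infinite_emitter[of E F v Z]
          vertex_weight_infinite_emitter[of E F v W]
        by (simp add: psubset_eq subset_trans[of Z W] del: gen_weight.simps(2))
      then show ?case
        using A3 by (simp add: weight_sum_heads distrib_left del: gen_weight.simps(2))
    qed
  qed
qed

text \<open>Intermediate elements of a derivation can demand more arcs than \<open>a\<close> and
  \<open>b\<close> do. Stating equality eventually along the filter of finite subsets combines these
  demands without naming a set.\<close>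

lemma sim_weight:
  assumes "sim E a b" and wf: "\<And>F. finite F \<Longrightarrow> F \<subseteq> arcs E \<Longrightarrow> wf (arc_rel E F)"
  shows "\<forall>\<^sub>F F in finite_subsets_at_top (arcs E). weight E F a = weight E F b"
  using assms(1)
proof induction
  case (sim_step a b)
  then show ?case
    using wf by (rule step1_weight)
next
  case (sim_sym a b)
  from sim_sym.IH show ?case
    by eventually_elim simp
next
  case (sim_trans a b c)
  from sim_trans.IH show ?case
    by eventually_elim simp
next
  case (sim_add a b c d)
  from sim_add.IH show ?case
    by eventually_elim simp
qed (simp_all add: weight_gamma_act)

lemma not_comparable_if_acyclic:
  assumes "acyclic (arcs_ends E)" "a \<noteq> {#}"
  shows "\<not> comparable E a"
proof
  assume "comparable E a"
  then obtain n c where n: "n > 0" and c: "sim E (gamma_act n a + c) a"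
    by (auto simp: comparable_def precsim_def)
  have wf: "wf (arc_rel E F)" if "finite F" "F \<subseteq> arcs E" for F
  proof (rule finite_acyclic_wf)
    show "finite (arc_rel E F)"
      using that by (simp add: arc_rel_def)
    \<comment> \<open>\<open>arc_rel\<close> points from heads to tails, hence the converse.\<close>
    have "arc_rel E F \<subseteq> (arcs_ends E)\<inverse>"
      using that by (auto simp: arc_rel_def arcs_ends_conv)
    with acyclic_converse[THEN iffD2, OF assms(1)] show "acyclic (arc_rel E F)"
      by (rule acyclic_subset)
  qed
  have "\<forall>\<^sub>F F in finite_subsets_at_top (arcs E).
      finite F \<and> F \<subseteq> arcs E \<and> weight E F (gamma_act n a + c) = weight E F a"
    by (intro eventually_conj eventually_finite_subsets_at_top_weakI sim_weight[OF c wf])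
  \<comment> \<open>The filter is proper, so what holds eventually holds for some single
    \<open>F\<close>.\<close>
  then obtain F where F: "finite F" "F \<subseteq> arcs E"
    and eq: "weight E F (gamma_act n a + c) = weight E F a"
    using eventually_happens'[OF finite_subsets_at_top_neq_bot] by blast
  note wf = wf[OF F]
  have "1 < (2 :: real) powi n"
    using n by (simp add: power_int_def one_less_power)
  then have "weight E F a < 2 powi n * weight E F a"
    using weight_pos[OF wf F(1) assms(2)] by simp
  with eq weight_nonneg[OF wf F(1), of c] show False
    by (simp add: weight_gamma_act)
qed

theorem corollary4p12:
  fixes E :: "('v, 'e) pre_digraph"
  assumes "wf_digraph E"
  shows "((\<exists>g\<in>generators E. comparable E (monom 0 g)) \<longleftrightarrow>
          (\<exists>a\<in>free_gamma_monoid E. a \<noteq> {#} \<and> comparable E a)) \<and>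
         ((\<exists>a\<in>free_gamma_monoid E. a \<noteq> {#} \<and> comparable E a) \<longleftrightarrow>
          (\<exists>p. is_cycle E p))"
proof -
  interpret wf_digraph E by fact
  have "\<exists>a\<in>free_gamma_monoid E. a \<noteq> {#} \<and> comparable E a"
    if "\<exists>g\<in>generators E. comparable E (monom 0 g)"
  proof -
    from that obtain g where "g \<in> generators E" "comparable E (monom 0 g)"
      by blast
    then show ?thesis
      by (intro bexI[of _ "monom 0 g"]) auto
  qed
  moreover have "\<exists>p. is_cycle E p" if "\<exists>a\<in>free_gamma_monoid E. a \<noteq> {#} \<and> comparable E a"
    using that not_comparable_if_acyclic[OF acyclic_if_no_cycle] by blast
  moreover have "\<exists>g\<in>generators E. comparable E (monom 0 g)" if "\<exists>p. is_cycle E p"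
  proof -
    from that obtain u p where "awalk u p u" "p \<noteq> []"
      by (auto simp: is_cycle_def)
    then have "comparable E (monom 0 (Proper u))" "Proper u \<in> generators E"
      using comparable_closed_walk Proper_in_generators[OF awalk_hd_in_verts] by simp_all
    then show ?thesis
      by (rule bexI)
  qed
  ultimately show ?thesis
    by argo
qed

end
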